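(* Let $\mathbf{1}\in\mathbb{R}^m$ be the all-ones vector and $\mathbf{I}$ the $m\times m$ identity matrix. For a matrix $D=(d_{ij})\in\mathbb{R}^{m\times m}$ let $D_{sq}=(d_{ij}^2)$ be the matrix whose entries are the squares of the entries of $D$, and for $\mathbf{s}\in\mathbb{R}^m$ put $$F=\left(\mathbf{I}-\mathbf{1}\mathbf{s}^T\right)\left(-\tfrac12\right) D_{sq}\left(\mathbf{I}-\mathbf{s}\mathbf{1}^T\right)=(f_{ij}).$$ 1. If $D$ is a matrix of Euclidean distances, then for each vector $\mathbf{s}$ such that $\mathbf{s}^T\mathbf{1}=1$ the matrix $F$ is positive semidefinite. 2. If $D$ is a symmetric matrix with zero diagonal and for a vector $\mathbf{s}$ such that $\mathbf{s}^T\mathbf{1}=1$ the matrix $F$ is positive semidefinite, then $D$ is Euclidean. 3. If $D$ is Euclidean, then for each vector $\mathbf{s}$ such that $\mathbf{s}^T\mathbf{1}=1$ the matrix $D$ can be derived from the matrix $F$ in such a way that its squared entries can be computed as $d_{ij}^2=f_{ii}+f_{jj}-2f_{ij}$. 4. If $D$ is Euclidean, then for each vector $\mathbf{s}$ such that $\mathbf{s}^T\mathbf{1}=1$ the matrix $F$ can be expressed as $F=YY^T$, where $Y$ is a real-valued matrix, and the rows of $Y$ can be considered as coordinates of data points the distances between which are those from the matrix $D$.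
   Context: A matrix $D=(d_{ij})\in\mathbb{R}^{m\times m}$ is called a Euclidean distance matrix ("matrix of Euclidean distances", or simply "Euclidean") if and only if there exists a matrix $X\in\mathbb{R}^{m\times n}$ (for some $n$) with rows $\mathbf{x}_1^T,\dots,\mathbf{x}_m^T$, the coordinate vectors of $m$ points in an $n$-dimensional Euclidean space, such that $d_{ij}=\sqrt{(\mathbf{x}_i-\mathbf{x}_j)^T(\mathbf{x}_i-\mathbf{x}_j)}$ for all $i,j$. A symmetric matrix $F$ is positive semidefinite if $\mathbf{u}^TF\mathbf{u}\ge 0$ for all real vectors $\mathbf{u}$.
   Formalization: Part 2 additionally assumes that the entries of D are nonnegative; without this it fails, e.g. for D with zero diagonal and off-diagonal entries −1 (m=2), s=(1/2,1/2), where F is positive semidefinite but D is not Euclidean. *)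

theory Defs
  imports Complex_Main "Jordan_Normal_Form.Matrix"
begin

text \<open>
  Matrices are those of \<^theory>\<open>Jordan_Normal_Form.Matrix\<close>, whose dimensions are natural
  numbers: the dimension \<open>n\<close> of the ambient space has to be quantified inside the formulas.
\<close>

definition row_distances :: "real mat \<Rightarrow> real mat" where
  "row_distances X = mat (dim_row X) (dim_row X)
     (\<lambda>(i, j). sqrt ((row X i - row X j) \<bullet> (row X i - row X j)))"

text \<open>
  The entries of a Euclidean matrix are nonnegative, being values of the real square root.
  Since \<open>gram_of\<close> below sees only their squares, nonnegativity has to be required
  separately whenever a matrix is to be recognised as Euclidean from \<open>gram_of D s\<close>.
\<close>

definition euclidean_matrix :: "real mat \<Rightarrow> bool" where
  "euclidean_matrix D \<longleftrightarrow> (\<exists>n. \<exists>X \<in> carrier_mat (dim_row D) n. D = row_distances X)"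

definition symmetric_matrix :: "real mat \<Rightarrow> bool" where
  "symmetric_matrix A \<longleftrightarrow> square_mat A \<and> transpose_mat A = A"

definition psd_matrix :: "real mat \<Rightarrow> bool" where
  "psd_matrix A \<longleftrightarrow> symmetric_matrix A \<and>
     (\<forall>u \<in> carrier_vec (dim_row A). u \<bullet> (A *\<^sub>v u) \<ge> 0)"

definition ones_vec :: "nat \<Rightarrow> real vec" where
  "ones_vec m = vec m (\<lambda>_. 1)"

text \<open>The product \<open>u v\<^sup>T\<close> of a column vector and a row vector.\<close>

definition outer :: "real vec \<Rightarrow> real vec \<Rightarrow> real mat" where
  "outer u v = mat (dim_vec u) (dim_vec v) (\<lambda>(i, j). u $ i * v $ j)"

text \<open>Squares are taken entrywise; this is not the matrix product \<open>D D\<close>.\<close>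

definition sq_entries :: "real mat \<Rightarrow> real mat" where
  "sq_entries D = map_mat (\<lambda>x. x\<^sup>2) D"

definition gram_of :: "real mat \<Rightarrow> real vec \<Rightarrow> real mat" where
  "gram_of D s = (let m = dim_row D in
     (1\<^sub>m m - outer (ones_vec m) s) * ((- 1 / 2) \<cdot>\<^sub>m sq_entries D)
       * (1\<^sub>m m - outer s (ones_vec m)))"

end

theory Submission
  imports Defs
begin

text \<open>
  Entrywise, \<open>f\<^sub>i\<^sub>j = -1/2 (d\<^sub>i\<^sub>j\<^sup>2 - r\<^sub>i - r\<^sub>j + c)\<close>, where \<open>r\<^sub>i\<close> is the \<open>s\<close>-weighted
  mean of row \<open>i\<close> of \<open>D\<^sub>s\<^sub>q\<close> and \<open>c\<close> that of \<open>r\<close>. The terms \<open>r\<close> and \<open>c\<close> cancel in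
  \<open>f\<^sub>i\<^sub>i + f\<^sub>j\<^sub>j - 2 f\<^sub>i\<^sub>j\<close>, so any factorisation \<open>F = Y Y\<^sup>T\<close> has \<open>D\<close> as its matrix of row distances.
  If \<open>D\<close> comes from points \<open>x\<^sub>i\<close>, translating them by their weighted mean \<open>\<Sum> s\<^sub>k x\<^sub>k\<close> yields such a \<open>Y\<close>;
  if \<open>F\<close> is only known to be positive semidefinite, \<open>Y\<close> is built by Cholesky elimination.
\<close>

section \<open>Factorisation of positive semidefinite kernels on finite sets\<close>

text \<open>With \<open>K p p = 0\<close>, the form at \<open>e_i + t e_p\<close> is affine in
  \<open>t\<close>; being bounded below, it has slope zero. This handles vanishing pivots in the
  elimination.\<close>

lemma psd_kernel_zero_column:
  fixes K :: "'a \<Rightarrow> 'a \<Rightarrow> real"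
  assumes "finite A" "i \<in> A" "p \<in> A"
    and sym: "\<And>i j. i \<in> A \<Longrightarrow> j \<in> A \<Longrightarrow> K i j = K j i"
    and psd: "\<And>u. 0 \<le> (\<Sum>i\<in>A. \<Sum>j\<in>A. u i * K i j * u j)"
    and zero: "K p p = 0"
  shows "K i p = 0"
proof (cases "i = p")
  case True
  then show ?thesis using zero by simp
next
  case False
  have form: "0 \<le> K i i + 2 * t * K i p" for t
  proof -
    define u where "u = (\<lambda>k. if k = i then 1 else if k = p then t else (0::real))"
    have red: "(\<Sum>k\<in>A. u k * g k) = g i + t * g p" for g
    proof -
      have "(\<Sum>k\<in>A. u k * g k) = (\<Sum>k\<in>{i, p}. u k * g k)"
        by (rule sum.mono_neutral_right) (use assms in \<open>auto simp: u_def\<close>)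
      then show ?thesis using False by (simp add: u_def)
    qed
    have "(\<Sum>k\<in>A. \<Sum>l\<in>A. u k * K k l * u l) = (\<Sum>k\<in>A. u k * (\<Sum>l\<in>A. u l * K k l))"
      by (simp add: sum_distrib_left mult_ac)
    also have "\<dots> = K i i + t * K i p + t * (K p i + t * K p p)"
      by (simp only: red)
    also have "\<dots> = K i i + 2 * t * K i p"
      using zero sym[OF \<open>p \<in> A\<close> \<open>i \<in> A\<close>] by simp
    finally show ?thesis using psd[of u] by simp
  qed
  show ?thesis
  proof (rule ccontr)
    \<comment> \<open>The chosen \<open>t\<close> brings the affine function to the value
      -1.\<close>
    assume "K i p \<noteq> 0"
    with form[of "- (K i i + 1) / (2 * K i p)"] show False by (simp add: field_simps)
  qed
qed

text \<open>Removing the pivot \<open>p\<close> leaves its Schur complement on \<open>A\<close>,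
  which is again positive semidefinite; the removed rank-one part contributes one more coordinate.
  Kernels on finite sets let the induction drop an index without resizing matrices.\<close>

lemma psd_kernel_factorization:
  fixes K :: "'a \<Rightarrow> 'a \<Rightarrow> real"
  assumes "finite A"
    and "\<And>i j. i \<in> A \<Longrightarrow> j \<in> A \<Longrightarrow> K i j = K j i"
    and "\<And>u. 0 \<le> (\<Sum>i\<in>A. \<Sum>j\<in>A. u i * K i j * u j)"
  shows "\<exists>n y. \<forall>i\<in>A. \<forall>j\<in>A. K i j = (\<Sum>a<(n::nat). y i a * y j a)"
  using assms
proof (induction A arbitrary: K rule: finite_induct)
  case empty
  show ?case by simp
next
  case (insert p A)
  note sym = insert.prems(1) and psd = insert.prems(2)
  have zero: "K i p = 0" if "K p p = 0" "i \<in> insert p A" for i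
    by (rule psd_kernel_zero_column[of "insert p A"])
       (use insert.hyps that sym psd in auto)
  have pp: "0 \<le> K p p"
  proof -
    have "(\<Sum>i\<in>insert p A. \<Sum>j\<in>insert p A. of_bool (i = p) * K i j * of_bool (j = p)) = K p p"
      using insert.hyps by (auto simp: intro!: sum.neutral)
    then show ?thesis using psd[of "\<lambda>i. of_bool (i = p)"] by simp
  qed
  \<comment> \<open>If \<open>K p p = 0\<close>, the junk value \<open>x / 0 = 0\<close> makes \<open>K'\<close> equal to \<open>K\<close>, which is what is wanted.\<close>
  define K' where "K' i j = K i j - K i p * K j p / K p p" for i j
  have psd': "0 \<le> (\<Sum>i\<in>A. \<Sum>j\<in>A. u i * K' i j * u j)" for u
  proof -
    define w where "w = (\<Sum>i\<in>A. u i * K i p)"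
    \<comment> \<open>For \<open>K p p > 0\<close> this value at \<open>p\<close> minimises the form
      for fixed \<open>u\<close> on \<open>A\<close>; completing the square leaves exactly the form
      of \<open>K'\<close>.\<close>
    define v where "v = u(p := - w / K p p)"
    have v: "v i = u i" if "i \<in> A" for i
      using that insert.hyps by (auto simp: v_def)
    have vp: "v p = - w / K p p" by (simp add: v_def)
    have w': "(\<Sum>j\<in>A. K p j * u j) = w"
      unfolding w_def using sym by (intro sum.cong) auto
    have w0: "w = 0" if "K p p = 0"
      unfolding w_def using zero[OF that] by simp
    have "(\<Sum>i\<in>insert p A. \<Sum>j\<in>insert p A. v i * K i j * v j)
        = v p * K p p * v p + v p * (\<Sum>j\<in>A. K p j * u j) + w * v p
          + (\<Sum>i\<in>A. \<Sum>j\<in>A. u i * K i j * u j)"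
      using insert.hyps
      by (simp add: v w_def sum.distrib sum_distrib_left sum_distrib_right mult.assoc cong: sum.cong)
    also have "\<dots> = (\<Sum>i\<in>A. \<Sum>j\<in>A. u i * K i j * u j) - w * w / K p p"
      using w0 unfolding w' vp by (cases "K p p = 0") (auto simp: field_simps)
    also have "\<dots> = (\<Sum>i\<in>A. \<Sum>j\<in>A. u i * K' i j * u j)"
    proof -
      have "w * w / K p p = (\<Sum>i\<in>A. \<Sum>j\<in>A. u i * (K i p * K j p / K p p) * u j)"
        unfolding w_def sum_product sum_divide_distrib by (simp add: mult_ac)
      then show ?thesis
        by (simp add: K'_def sum_subtractf algebra_simps)
    qed
    finally show ?thesis using psd[of v] by simp
  qed
  have "\<exists>n y. \<forall>i\<in>A. \<forall>j\<in>A. K' i j = (\<Sum>a<(n::nat). y i a * y j a)"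
    using psd' sym by (intro insert.IH) (auto simp: K'_def mult.commute)
  then obtain n :: nat and y where
    y: "K' i j = (\<Sum>a<n. y i a * y j a)" if "i \<in> A" "j \<in> A" for i j
    by blast
  \<comment> \<open>The induction hypothesis says nothing about \<open>y p\<close>, so its
    coordinates are set to 0; coordinate \<open>n\<close> carries the scaled pivot column, which is
    0 when \<open>K p p = 0\<close>.\<close>
  define z where "z i a = (if a < n then (if i = p then 0 else y i a) else K i p / sqrt (K p p))"
    for i a
  have "K i j = (\<Sum>a<Suc n. z i a * z j a)" if "i \<in> insert p A" "j \<in> insert p A" for i j
  proof -
    have "z i n * z j n = K i p * K j p / K p p"
      using pp by (simp add: z_def)
    moreover have "(\<Sum>a<n. z i a * z j a) = (if i = p \<or> j = p then 0 else K' i j)"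
      using that y by (auto simp: z_def)
    \<comment> \<open>When \<open>i\<close> or \<open>j\<close> is \<open>p\<close>, only coordinate
      \<open>n\<close> contributes; there \<open>K p p\<close> cancels, or vanishes and
      \<open>zero\<close> makes both sides 0.\<close>
    ultimately show ?thesis
      using that zero sym[OF that] sym[of p j] by (auto simp: K'_def)
  qed
  then show ?case by blast
qed

section \<open>Positive semidefinite matrices and products
  \<open>Y * transpose_mat Y\<close>\<close>

lemma symmetric_matrixD:
  assumes "symmetric_matrix A" "A \<in> carrier_mat m m" "i < m" "j < m"
  shows "A $$ (i, j) = A $$ (j, i)"
  using assms by (metis carrier_matD index_transpose_mat(1) symmetric_matrix_def)

lemma psd_matrix_factorization:
  assumes "psd_matrix F" "F \<in> carrier_mat m m"
  obtains n Y where "Y \<in> carrier_mat m n" "F = Y * transpose_mat Y"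
proof -
  have "\<exists>n y. \<forall>i\<in>{0..<m}. \<forall>j\<in>{0..<m}. F $$ (i, j) = (\<Sum>a<(n::nat). y i a * y j a)"
  proof (rule psd_kernel_factorization)
    fix u :: "nat \<Rightarrow> real"
    have "0 \<le> vec m u \<bullet> (F *\<^sub>v vec m u)"
      using assms by (auto simp: psd_matrix_def)
    also have "\<dots> = (\<Sum>i\<in>{0..<m}. \<Sum>j\<in>{0..<m}. u i * F $$ (i, j) * u j)"
      using assms(2) by (simp add: scalar_prod_def sum_distrib_left mult.assoc)
    finally show "0 \<le> (\<Sum>i\<in>{0..<m}. \<Sum>j\<in>{0..<m}. u i * F $$ (i, j) * u j)" .
  qed (use assms symmetric_matrixD in \<open>auto simp: psd_matrix_def\<close>)
  then obtain n y where
    y: "F $$ (i, j) = (\<Sum>a<(n::nat). y i a * y j a)" if "i < m" "j < m" for i j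
    by fastforce
  define Y where "Y = mat m n (\<lambda>(i, a). y i a)"
  have "F = Y * transpose_mat Y"
    using assms(2) y by (intro eq_matI) (auto simp: Y_def scalar_prod_def lessThan_atLeast0)
  moreover have "Y \<in> carrier_mat m n" by (simp add: Y_def)
  ultimately show ?thesis using that by blast
qed

lemma psd_matrix_mult_transpose: "psd_matrix (Y * transpose_mat Y)"
proof -
  have Y: "Y \<in> carrier_mat (dim_row Y) (dim_col Y)" and
    T: "transpose_mat Y \<in> carrier_mat (dim_col Y) (dim_row Y)"
    by auto
  have "u \<bullet> (Y * transpose_mat Y *\<^sub>v u) \<ge> 0" if u: "u \<in> carrier_vec (dim_row Y)" for u
  proof -
    note Tu = mult_mat_vec_carrier[OF T u]
    have "u \<bullet> (Y * transpose_mat Y *\<^sub>v u) = u \<bullet> (Y *\<^sub>v (transpose_mat Y *\<^sub>v u))"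
      by (simp only: assoc_mult_mat_vec[OF Y T u])
    also have "\<dots> = (transpose_mat Y *\<^sub>v u) \<bullet> (transpose_mat Y *\<^sub>v u)"
      by (rule transpose_vec_mult_scalar[OF Y Tu u, symmetric])
    also have "\<dots> \<ge> 0"
      by (simp add: scalar_prod_def sum_nonneg)
    finally show ?thesis .
  qed
  moreover have "transpose_mat (Y * transpose_mat Y) = Y * transpose_mat Y"
    by (simp only: transpose_mult[OF Y T] transpose_transpose)
  ultimately show ?thesis
    by (simp add: psd_matrix_def symmetric_matrix_def)
qed

section \<open>Entries of \<open>gram_of\<close> and recovery of squared distances\<close>

lemma gram_of_carrier:
  assumes "D \<in> carrier_mat m m" "s \<in> carrier_vec m"
  shows "gram_of D s \<in> carrier_mat m m"
  using assms by (intro carrier_matI) (simp_all add: gram_of_def Let_def outer_def ones_vec_def)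

text \<open>The left factor subtracts from each column its weighted mean, the right factor does the
  same for rows. The two kinds of mean stay separate until symmetry identifies them.\<close>

lemma gram_of_entry:
  assumes D: "D \<in> carrier_mat m m" and s: "s \<in> carrier_vec m" and ij: "i < m" "j < m"
  shows "gram_of D s $$ (i, j) = - 1 / 2 * ((D $$ (i, j))\<^sup>2
    - (\<Sum>k<m. s $ k * (D $$ (k, j))\<^sup>2) - (\<Sum>k<m. s $ k * (D $$ (i, k))\<^sup>2)
    + (\<Sum>k<m. s $ k * (\<Sum>l<m. s $ l * (D $$ (l, k))\<^sup>2)))"
proof -
  let ?H = "(- 1 / 2) \<cdot>\<^sub>m sq_entries D"
  let ?A = "1\<^sub>m m - outer (ones_vec m) s" and ?B = "1\<^sub>m m - outer s (ones_vec m)"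
  have carr: "?H \<in> carrier_mat m m" "?A \<in> carrier_mat m m" "?B \<in> carrier_mat m m"
    using D s by (auto simp: sq_entries_def outer_def ones_vec_def)
  have A: "?A $$ (a, k) = of_bool (k = a) - s $ k" if "a < m" "k < m" for a k
    using that s by (auto simp: outer_def ones_vec_def)
  have B: "?B $$ (k, b) = of_bool (k = b) - s $ k" if "k < m" "b < m" for k b
    using that s by (simp add: outer_def ones_vec_def)
  have H: "?H $$ (k, l) = - 1 / 2 * (D $$ (k, l))\<^sup>2" if "k < m" "l < m" for k l
    using that D by (simp add: sq_entries_def)
  \<comment> \<open>The effect of identity minus rank one on a vector \<open>g\<close>, used once
    for each outer factor.\<close>
  have delta: "(\<Sum>k<m. (of_bool (k = a) - t k) * g k) = g a - (\<Sum>k<m. t k * g k)"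
    if "a < m" for a and t g :: "nat \<Rightarrow> real"
  proof -
    have "(\<Sum>k<m. (of_bool (k = a) - t k) * g k)
        = (\<Sum>k<m. if k = a then g k else 0) - (\<Sum>k<m. t k * g k)"
      unfolding sum_subtractf[symmetric] by (intro sum.cong) (auto simp: algebra_simps)
    then show ?thesis using that by simp
  qed
  have AH: "(?A * ?H) $$ (i, k)
      = - 1 / 2 * ((D $$ (i, k))\<^sup>2 - (\<Sum>l<m. s $ l * (D $$ (l, k))\<^sup>2))" if "k < m" for k
  proof -
    \<comment> \<open>The deleted simp rules would unfold the entries of \<open>?A\<close> and
      \<open>?H\<close> before the facts \<open>A\<close> and \<open>H\<close> can match
      them.\<close>
    have "(?A * ?H) $$ (i, k) = (\<Sum>l<m. ?A $$ (i, l) * ?H $$ (l, k))"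
      using carr ij that by (simp add: scalar_prod_def lessThan_atLeast0 del: index_minus_mat index_smult_mat)
    also have "\<dots> = (\<Sum>l<m. (of_bool (l = i) - s $ l) * (- 1 / 2 * (D $$ (l, k))\<^sup>2))"
      using ij that by (intro sum.cong) (simp_all only: A H lessThan_iff)
    also have "\<dots> = - 1 / 2 * (D $$ (i, k))\<^sup>2 - (\<Sum>l<m. s $ l * (- 1 / 2 * (D $$ (l, k))\<^sup>2))"
      using ij by (simp only: delta)
    also have "(\<Sum>l<m. s $ l * (- 1 / 2 * (D $$ (l, k))\<^sup>2)) = - 1 / 2 * (\<Sum>l<m. s $ l * (D $$ (l, k))\<^sup>2)"
      by (simp add: sum_distrib_left mult_ac)
    finally show ?thesis by (simp add: algebra_simps)
  qed
  have "gram_of D s $$ (i, j) = (?A * ?H * ?B) $$ (i, j)"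
    using D by (simp add: gram_of_def)
  also have "\<dots> = (\<Sum>k<m. ?B $$ (k, j) * (?A * ?H) $$ (i, k))"
    using carr ij by (simp add: scalar_prod_def lessThan_atLeast0 mult.commute del: index_minus_mat index_smult_mat assoc_mult_mat)
  also have "\<dots> = (\<Sum>k<m. (of_bool (k = j) - s $ k) *
      (- 1 / 2 * ((D $$ (i, k))\<^sup>2 - (\<Sum>l<m. s $ l * (D $$ (l, k))\<^sup>2))))"
    using ij by (intro sum.cong) (simp_all only: B AH lessThan_iff)
  also have "\<dots> = - 1 / 2 * ((D $$ (i, j))\<^sup>2 - (\<Sum>l<m. s $ l * (D $$ (l, j))\<^sup>2))
      - (\<Sum>k<m. s $ k * (- 1 / 2 * ((D $$ (i, k))\<^sup>2 - (\<Sum>l<m. s $ l * (D $$ (l, k))\<^sup>2))))"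
    using ij by (simp only: delta)
  also have "(\<Sum>k<m. s $ k * (- 1 / 2 * ((D $$ (i, k))\<^sup>2 - (\<Sum>l<m. s $ l * (D $$ (l, k))\<^sup>2))))
      = - 1 / 2 * ((\<Sum>k<m. s $ k * (D $$ (i, k))\<^sup>2)
        - (\<Sum>k<m. s $ k * (\<Sum>l<m. s $ l * (D $$ (l, k))\<^sup>2)))"
    unfolding sum_subtractf[symmetric] sum_distrib_left[of "- 1 / 2"]
    by (intro sum.cong) (auto simp: algebra_simps)
  finally show ?thesis by (simp add: algebra_simps)
qed

text \<open>Symmetry equates row and column means, and the zero diagonal gives f_ii = r_i - c / 2,
  so all means cancel.\<close>

lemma sq_dist_eq_gram_of:
  assumes D: "D \<in> carrier_mat m m" and s: "s \<in> carrier_vec m"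
    and sym: "symmetric_matrix D" and diag: "\<And>i. i < m \<Longrightarrow> D $$ (i, i) = 0"
    and ij: "i < m" "j < m"
  shows "(D $$ (i, j))\<^sup>2 =
    gram_of D s $$ (i, i) + gram_of D s $$ (j, j) - 2 * gram_of D s $$ (i, j)"
proof -
  have "(\<Sum>k<m. s $ k * (D $$ (k, i))\<^sup>2) = (\<Sum>k<m. s $ k * (D $$ (i, k))\<^sup>2)" if "i < m" for i
    by (intro sum.cong) (use that symmetric_matrixD[OF sym D] in auto)
  then show ?thesis
    using ij diag by (simp add: gram_of_entry[OF D s] field_simps)
qed

section \<open>From a factor of \<open>gram_of D s\<close> to points realising
  \<open>D\<close>\<close>

lemma row_distances_entry:
  assumes "X \<in> carrier_mat m n" "i < m" "j < m"
  shows "row_distances X $$ (i, j) = sqrt (\<Sum>a<n. (X $$ (i, a) - X $$ (j, a))\<^sup>2)"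
  using assms by (simp add: row_distances_def scalar_prod_def lessThan_atLeast0 power2_eq_square)

text \<open>Expanding the squared distance of two rows of \<open>Y\<close> gives f_ii + f_jj - 2
  f_ij. It serves both when points are given and when they have to be constructed.\<close>

lemma row_distances_gram_factor:
  assumes D: "D \<in> carrier_mat m m" and s: "s \<in> carrier_vec m"
    and sym: "symmetric_matrix D" and diag: "\<And>i. i < m \<Longrightarrow> D $$ (i, i) = 0"
    and nonneg: "\<And>i j. i < m \<Longrightarrow> j < m \<Longrightarrow> 0 \<le> D $$ (i, j)"
    and Y: "Y \<in> carrier_mat m n" and F: "gram_of D s = Y * transpose_mat Y"
  shows "row_distances Y = D"
proof (rule eq_matI)
  fix i j
  assume "i < dim_row D" "j < dim_col D"
  then have ij: "i < m" "j < m" using D by auto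
  have entry: "gram_of D s $$ (i, j) = (\<Sum>a<n. Y $$ (i, a) * Y $$ (j, a))"
    if "i < m" "j < m" for i j
    using Y that by (simp add: F scalar_prod_def lessThan_atLeast0)
  have "(\<Sum>a<n. (Y $$ (i, a) - Y $$ (j, a))\<^sup>2) = (D $$ (i, j))\<^sup>2"
  proof -
    have "(\<Sum>a<n. (Y $$ (i, a) - Y $$ (j, a))\<^sup>2)
        = gram_of D s $$ (i, i) + gram_of D s $$ (j, j) - 2 * gram_of D s $$ (i, j)"
      unfolding entry[OF ij(1) ij(1)] entry[OF ij(2) ij(2)] entry[OF ij]
        sum_distrib_left sum.distrib[symmetric] sum_subtractf[symmetric]
      by (intro sum.cong) (auto simp: power2_eq_square algebra_simps)
    also have "\<dots> = (D $$ (i, j))\<^sup>2"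
      using sq_dist_eq_gram_of[OF D s sym _ ij] diag by simp
    finally show ?thesis .
  qed
  \<comment> \<open>The root of a square is an absolute value; \<open>nonneg\<close> removes
    it.\<close>
  then show "row_distances Y $$ (i, j) = D $$ (i, j)"
    using nonneg[OF ij] by (simp add: row_distances_entry[OF Y ij])
qed (use D Y in \<open>auto simp: row_distances_def\<close>)

lemma euclidean_matrix_basic:
  assumes "euclidean_matrix D" "D \<in> carrier_mat m m"
  shows "symmetric_matrix D"
    and "i < m \<Longrightarrow> D $$ (i, i) = 0"
    and "i < m \<Longrightarrow> j < m \<Longrightarrow> 0 \<le> D $$ (i, j)"
proof -
  obtain n X where X: "X \<in> carrier_mat m n" and DX: "D = row_distances X"
    using assms by (auto simp: euclidean_matrix_def)
  note entry = row_distances_entry[OF X]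
  show "symmetric_matrix D"
    unfolding symmetric_matrix_def
  proof
    show "square_mat D" using assms(2) by auto
    show "transpose_mat D = D"
      using assms(2) by (intro eq_matI) (auto simp: DX entry power2_commute)
  qed
  show "i < m \<Longrightarrow> D $$ (i, i) = 0" by (simp add: DX entry)
  show "i < m \<Longrightarrow> j < m \<Longrightarrow> 0 \<le> D $$ (i, j)" by (simp add: DX entry sum_nonneg)
qed

section \<open>Centering a given configuration of points\<close>

text \<open>The one-dimensional case: by \<open>mean\<close>, a weighted mean of squared differences
  is a quadratic polynomial in the base point \<open>t\<close>, so only \<open>q\<close> and
  \<open>c\<close> survive, and \<open>q\<close> cancels.\<close>

lemma centered_product:
  fixes x s :: "nat \<Rightarrow> real"
  assumes "(\<Sum>k<m. s k) = 1"
  defines "c \<equiv> \<Sum>k<m. s k * x k"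
  shows "- 1 / 2 * ((x i - x j)\<^sup>2 - (\<Sum>k<m. s k * (x k - x j)\<^sup>2) - (\<Sum>k<m. s k * (x i - x k)\<^sup>2)
     + (\<Sum>k<m. s k * (\<Sum>l<m. s l * (x l - x k)\<^sup>2))) = (x i - c) * (x j - c)"
proof -
  define q where "q = (\<Sum>k<m. s k * (x k)\<^sup>2)"
  have mean: "(\<Sum>k<m. s k * (x k - t)\<^sup>2) = q - 2 * t * c + t\<^sup>2" for t
  proof -
    have "(\<Sum>k<m. s k * (x k - t)\<^sup>2)
        = (\<Sum>k<m. s k * (x k)\<^sup>2) - 2 * t * (\<Sum>k<m. s k * x k) + (\<Sum>k<m. s k) * t\<^sup>2"
      unfolding sum_distrib_left sum_distrib_right sum.distrib[symmetric] sum_subtractf[symmetric]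
      by (intro sum.cong) (auto simp: power2_eq_square algebra_simps)
    then show ?thesis by (simp add: assms q_def)
  qed
  \<comment> \<open>The nested sum is \<open>mean\<close> at \<open>t = x k\<close>, averaged once
    more.\<close>
  have "(\<Sum>k<m. s k * (q - 2 * x k * c + (x k)\<^sup>2))
      = (\<Sum>k<m. s k) * q - 2 * c * (\<Sum>k<m. s k * x k) + (\<Sum>k<m. s k * (x k)\<^sup>2)"
    unfolding sum_distrib_left sum_distrib_right sum.distrib[symmetric] sum_subtractf[symmetric]
    by (intro sum.cong) (auto simp: algebra_simps)
  then have total: "(\<Sum>k<m. s k * (q - 2 * x k * c + (x k)\<^sup>2)) = 2 * q - 2 * c\<^sup>2"
    by (simp add: assms q_def power2_eq_square)
  \<comment> \<open>Reversing the differences gives the sum based at \<open>x i\<close> the shape of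
    \<open>mean\<close>.\<close>
  show ?thesis
    unfolding power2_commute[of "x i" "x k" for k] mean total
    by (simp add: power2_eq_square field_simps)
qed

text \<open>Entries of \<open>gram_of\<close> are linear in the squared distances, which are sums
  over coordinates; hence \<open>centered_product\<close> applies coordinatewise.\<close>

lemma euclidean_matrix_gram_factor:
  assumes D: "D \<in> carrier_mat m m" and s: "s \<in> carrier_vec m"
    and "euclidean_matrix D" and s1: "s \<bullet> ones_vec m = 1"
  obtains n Y where "Y \<in> carrier_mat m n" "gram_of D s = Y * transpose_mat Y"
proof -
  obtain n X where X: "X \<in> carrier_mat m n" and DX: "D = row_distances X"
    using assms by (auto simp: euclidean_matrix_def)
  have s1': "(\<Sum>k<m. s $ k) = 1"
    using s1 by (simp add: scalar_prod_def ones_vec_def lessThan_atLeast0)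
  define c where "c a = (\<Sum>k<m. s $ k * X $$ (k, a))" for a
  define Y where "Y = mat m n (\<lambda>(i, a). X $$ (i, a) - c a)"
  have Y: "Y \<in> carrier_mat m n" by (simp add: Y_def)
  have sq: "(D $$ (i, j))\<^sup>2 = (\<Sum>a<n. (X $$ (i, a) - X $$ (j, a))\<^sup>2)" if "i < m" "j < m" for i j
    using row_distances_entry[OF X that] by (simp add: DX sum_nonneg)
  have "gram_of D s $$ (i, j) = (Y * transpose_mat Y) $$ (i, j)" if ij: "i < m" "j < m" for i j
  proof -
    let ?d = "\<lambda>i j a. (X $$ (i, a) - X $$ (j, a))\<^sup>2"
    \<comment> \<open>Moves the coordinate sum outside the weighted means; the nested mean takes two
      applications.\<close>
    have swap: "(\<Sum>k<m. s $ k * (\<Sum>a<n. g k a)) = (\<Sum>a<n. \<Sum>k<m. s $ k * g k a)" for g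
      unfolding sum_distrib_left by (rule sum.swap)
    have "gram_of D s $$ (i, j) = - 1 / 2 * ((\<Sum>a<n. ?d i j a)
        - (\<Sum>k<m. s $ k * (\<Sum>a<n. ?d k j a)) - (\<Sum>k<m. s $ k * (\<Sum>a<n. ?d i k a))
        + (\<Sum>k<m. s $ k * (\<Sum>l<m. s $ l * (\<Sum>a<n. ?d l k a))))"
      using ij by (simp add: gram_of_entry[OF D s ij] sq cong: sum.cong_simp)
    also have "\<dots> = (\<Sum>a<n. - 1 / 2 * (?d i j a
        - (\<Sum>k<m. s $ k * ?d k j a) - (\<Sum>k<m. s $ k * ?d i k a)
        + (\<Sum>k<m. s $ k * (\<Sum>l<m. s $ l * ?d l k a))))"
      by (simp only: swap sum_distrib_left[symmetric] sum.distrib[symmetric] sum_subtractf[symmetric])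
    also have "\<dots> = (\<Sum>a<n. (X $$ (i, a) - c a) * (X $$ (j, a) - c a))"
      unfolding c_def by (intro sum.cong refl centered_product s1')
    also have "\<dots> = (Y * transpose_mat Y) $$ (i, j)"
      using ij by (simp add: Y_def scalar_prod_def lessThan_atLeast0)
    finally show ?thesis .
  qed
  then have "gram_of D s = Y * transpose_mat Y"
    using gram_of_carrier[OF D s] Y by (intro eq_matI) auto
  with Y show ?thesis using that by blast
qed

theorem theorem3:
  fixes m :: nat and D :: "real mat"
  assumes "D \<in> carrier_mat m m"
  shows
    "(euclidean_matrix D \<longrightarrow>
        (\<forall>s \<in> carrier_vec m. s \<bullet> ones_vec m = 1 \<longrightarrow> psd_matrix (gram_of D s)))
   \<and> (symmetric_matrix D \<and> (\<forall>i<m. D $$ (i, i) = 0) \<and> (\<forall>i<m. \<forall>j<m. 0 \<le> D $$ (i, j)) \<longrightarrow>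
        (\<forall>s \<in> carrier_vec m. s \<bullet> ones_vec m = 1 \<and> psd_matrix (gram_of D s) \<longrightarrow>
           euclidean_matrix D))
   \<and> (euclidean_matrix D \<longrightarrow>
        (\<forall>s \<in> carrier_vec m. s \<bullet> ones_vec m = 1 \<longrightarrow>
           (\<forall>i<m. \<forall>j<m. (D $$ (i, j))\<^sup>2 =
              gram_of D s $$ (i, i) + gram_of D s $$ (j, j) - 2 * gram_of D s $$ (i, j))))
   \<and> (euclidean_matrix D \<longrightarrow>
        (\<forall>s \<in> carrier_vec m. s \<bullet> ones_vec m = 1 \<longrightarrow>
           (\<exists>n. \<exists>Y \<in> carrier_mat m n.
              gram_of D s = Y * transpose_mat Y \<and> row_distances Y = D)))"
proof (intro conjI impI ballI)
  fix s
  assume E: "euclidean_matrix D" and s: "s \<in> carrier_vec m" and s1: "s \<bullet> ones_vec m = 1"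
  note basic = euclidean_matrix_basic[OF E assms]
  \<comment> \<open>This factor, the centered points, yields both semidefiniteness and the
    realisation of \<open>D\<close>.\<close>
  obtain n Y where Y: "Y \<in> carrier_mat m n" and F: "gram_of D s = Y * transpose_mat Y"
    by (rule euclidean_matrix_gram_factor[OF assms s E s1])
  show "psd_matrix (gram_of D s)"
    unfolding F by (rule psd_matrix_mult_transpose)
  show "\<forall>i<m. \<forall>j<m. (D $$ (i, j))\<^sup>2 =
      gram_of D s $$ (i, i) + gram_of D s $$ (j, j) - 2 * gram_of D s $$ (i, j)"
    using sq_dist_eq_gram_of[OF assms s basic(1,2)] by blast
  show "\<exists>n. \<exists>Y \<in> carrier_mat m n. gram_of D s = Y * transpose_mat Y \<and> row_distances Y = D"
    using row_distances_gram_factor[OF assms s basic Y F] Y F by blast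
next
  fix s
  assume D: "symmetric_matrix D \<and> (\<forall>i<m. D $$ (i, i) = 0) \<and> (\<forall>i<m. \<forall>j<m. 0 \<le> D $$ (i, j))"
    and s: "s \<in> carrier_vec m" and psd: "s \<bullet> ones_vec m = 1 \<and> psd_matrix (gram_of D s)"
  \<comment> \<open>Here no points are given: elimination supplies \<open>Y\<close>, whose rows
    become the points.\<close>
  obtain n Y where Y: "Y \<in> carrier_mat m n" and F: "gram_of D s = Y * transpose_mat Y"
    by (rule psd_matrix_factorization[OF conjunct2[OF psd] gram_of_carrier[OF assms s]])
  have "row_distances Y = D"
    by (rule row_distances_gram_factor[OF assms s _ _ _ Y F]) (use D in auto)
  then show "euclidean_matrix D"
    using Y assms by (auto simp: euclidean_matrix_def)
qed

end
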